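(* Let $q$ be a prime power and let $\epsilon=(u_1,v_1,u_2,v_2,u_3,v_3,u_4,v_4)$ be a tuple over $\mathbb{F}_q^*$. (a) $\Lambda_{3,q}$ has a cycle of type $\epsilon$ with $v_1+v_2=0$ iff $\epsilon=(r,s,t,-s,-r,s,-t,-s)$ for some $r,s,t\in\mathbb{F}_q^*$. (b) $\Lambda_{4,q}$ has a cycle of type $\epsilon$ with $v_1+v_2=0$ iff the characteristic of $\mathbb{F}_q$ is $2$ and $\epsilon=(r,s,t,-s,-r,s,-t,-s)$ for some $r,s,t\in\mathbb{F}_q^*$. (c) $\Lambda_{3,q}$ has a cycle of type $\epsilon$ with $v_1+v_2\ne0$ iff there exist $t\in\mathbb{F}_q^*$ and distinct $a,b,c\in\mathbb{F}_q^*$ with $v_1=a$, $v_2=b-a$, $v_3=c-b$, $v_4=-c$, $u_2=tbc(c-b)$, $u_3=tac(a-c)$, $u_4=tab(b-a)$, $u_1=t(c-b)(a-c)(b-a)$. (d) $\Lambda_{4,q}$ has a cycle of type $\epsilon$ with $v_1+v_2\ne0$ iff there exist $t\in\mathbb{F}_q^*$ and distinct $a,b,c\in\mathbb{F}_q^*$ with $a+c=b$ such that the equalities in (c) hold. (e) For $q>3$, $g(\Lambda_{3,q})=g(\Lambda_{4,q})=8$. (f) $g(\Lambda_{3,3})=8$ and $g(\Lambda_{4,3})\ge10$. (g) For $q\ge3$, $g(\Lambda_{5,q})\ge10$.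
   Context: For a prime power $q$ and integer $k\ge2$, $\Lambda_{k,q}$ is the bipartite graph with vertex set $L_k\cup R_k$ (regarded as disjoint), where $L_k$ is the set of vectors $[l]=(l_0,\dots,l_k)\in\mathbb{F}_q^{k+1}$ with $l_1=l_2$ and $R_k$ the set of vectors $\langle r\rangle=(r_0,\dots,r_k)\in\mathbb{F}_q^{k+1}$ with $r_1=0$; edges join only $L_k$ to $R_k$, and $[l]\sim\langle r\rangle$ iff for every $2\le i\le k$: $l_i+r_i=r_0l_{i-2}$ if $i\equiv2,3\pmod4$, and $l_i+r_i=l_0r_{i-2}$ if $i\equiv0,1\pmod4$. A cycle of length $2n$ through the edge joining the two all-zero vectors is written $[l^{(1)}],\langle r^{(1)}\rangle,\dots,[l^{(n)}],\langle r^{(n)}\rangle$ (distinct vertices, consecutive ones adjacent, $\langle r^{(n)}\rangle\sim[l^{(1)}]$) with $[l^{(1)}]$ and $\langle r^{(1)}\rangle$ the all-zero vectors. Put $x_i=l^{(i)}_0$, $y_i=r^{(i)}_0$ ($1\le i\le n$), $x_{n+1}=y_{n+1}=0$, $u_i=x_{i+1}-x_i$, $v_i=y_{i+1}-y_i$; the tuple $(u_1,v_1,\dots,u_n,v_n)$ is the type of the cycle, and "$\Lambda_{k,q}$ has a cycle of type $\epsilon$" means such a cycle with type $\epsilon$ exists. $g(G)$ is the girth of $G$. *)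

theory Defs
  imports
    "Jordan_Normal_Form.Matrix"
    "HOL-Library.Cardinality"
    "HOL-Library.Extended_Nat"
begin

text \<open>
  A simple graph is a pair of a vertex set and a set of edges, each edge being an unordered pair
  of vertices. A cycle is given by the cyclic list of its vertices, so its length is the length of
  that list.
\<close>

type_synonym 'v ugraph = "'v set \<times> 'v set set"

definition is_cycle :: "'v ugraph \<Rightarrow> 'v list \<Rightarrow> bool" where
  "is_cycle G c \<longleftrightarrow>
     3 \<le> length c \<and> distinct c \<and> set c \<subseteq> fst G \<and>
     (\<forall>i < length c. {c ! i, c ! (Suc i mod length c)} \<in> snd G)"

text \<open>The girth of an acyclic graph is \<open>\<infinity>\<close>, the infimum of the empty set.\<close>

definition girth :: "'v ugraph \<Rightarrow> enat" where
  "girth G = (INF c \<in> {c. is_cycle G c}. enat (length c))"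

text \<open>
  The two vertex classes of \<open>\<Lambda>\<^sub>k\<^sub>,\<^sub>q\<close> over the finite field \<open>'a\<close> of order \<open>q\<close>.
  Coordinates are indexed from \<open>0\<close> to \<open>k\<close>; the classes are made disjoint by the sum type.
\<close>

definition L_set :: "nat \<Rightarrow> 'a::field vec set" where
  "L_set k = {l \<in> carrier_vec (k + 1). l $ 1 = l $ 2}"

definition R_set :: "nat \<Rightarrow> 'a::field vec set" where
  "R_set k = {r \<in> carrier_vec (k + 1). r $ 1 = 0}"

definition incident :: "nat \<Rightarrow> 'a::field vec \<Rightarrow> 'a vec \<Rightarrow> bool" where
  "incident k l r \<longleftrightarrow>
     (\<forall>i \<in> {2..k}.
        (i mod 4 \<in> {2, 3} \<longrightarrow> l $ i + r $ i = r $ 0 * l $ (i - 2)) \<and>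
        (i mod 4 \<in> {0, 1} \<longrightarrow> l $ i + r $ i = l $ 0 * r $ (i - 2)))"

definition Lambda_graph :: "nat \<Rightarrow> ('a::field vec + 'a vec) ugraph" where
  "Lambda_graph k =
     (Inl ` L_set k \<union> Inr ` R_set k,
      {{Inl l, Inr r} | l r. l \<in> L_set k \<and> r \<in> R_set k \<and> incident k l r})"

text \<open>
  The vertices of a cycle are listed as \<open>[l\<^sub>1], \<langle>r\<^sub>1\<rangle>, \<dots>, [l\<^sub>n], \<langle>r\<^sub>n\<rangle>\<close>, with the \<open>l\<^sub>i\<close> and the \<open>r\<^sub>i\<close>
  collected in the lists \<open>ls\<close> and \<open>rs\<close>.
\<close>

definition interleave :: "'b list \<Rightarrow> 'b list \<Rightarrow> ('b + 'b) list" where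
  "interleave ls rs = concat (map2 (\<lambda>l r. [Inl l, Inr r]) ls rs)"

text \<open>
  The type \<open>(u\<^sub>1, v\<^sub>1, \<dots>, u\<^sub>n, v\<^sub>n)\<close>, with indices shifted to start at \<open>0\<close>. The appended \<open>0\<close>
  is the convention \<open>x\<^sub>n\<^sub>+\<^sub>1 = y\<^sub>n\<^sub>+\<^sub>1 = 0\<close>.
\<close>

definition cycle_type :: "'a::field vec list \<Rightarrow> 'a vec list \<Rightarrow> 'a list" where
  "cycle_type ls rs =
     (let x = map (\<lambda>l. l $ 0) ls @ [0]; y = map (\<lambda>r. r $ 0) rs @ [0]
      in concat (map (\<lambda>i. [x ! Suc i - x ! i, y ! Suc i - y ! i]) [0..<length ls]))"

definition has_cycle_of_type :: "nat \<Rightarrow> 'a::field list \<Rightarrow> bool" where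
  "has_cycle_of_type k \<epsilon> \<longleftrightarrow>
     (\<exists>ls rs. length ls = length rs \<and>
        is_cycle (Lambda_graph k) (interleave ls rs) \<and>
        ls ! 0 = 0\<^sub>v (k + 1) \<and> rs ! 0 = 0\<^sub>v (k + 1) \<and>
        cycle_type ls rs = \<epsilon>)"

end

theory Submission
  imports Defs
begin

text \<open>
  Write \<open>x\<^sub>i\<close>, \<open>y\<^sub>i\<close> for the leading coordinates along a closed walk and \<open>u\<^sub>i\<close>, \<open>v\<^sub>i\<close> for their
  increments. Eliminating the remaining coordinates by telescoping and summation by parts, the walk
  closes up in coordinates \<open>2, 3, 4, 5\<close> only if, respectively, \<open>\<Sum> y\<^sub>i u\<^sub>i = 0\<close>, \<open>\<Sum> y\<^sub>i\<^sup>2 u\<^sub>i = 0\<close>,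
  \<open>\<Sum> x\<^sub>i\<^sub>+\<^sub>1\<^sup>2 v\<^sub>i = 0\<close> and \<open>\<Sum> x\<^sub>i\<^sub>+\<^sub>1 p\<^sub>i\<^sub>+\<^sub>1 v\<^sub>i = 0\<close>, where \<open>p\<^sub>i\<close> is coordinate \<open>2\<close> of \<open>l\<^sub>i\<close>.
  Together with \<open>\<Sum> u\<^sub>i = 0\<close> the first two form a Vandermonde system in the \<open>u\<^sub>i\<close>: it has no
  admissible solution for lengths 4 and 6, while for length 8 its solutions are the two families of
  the theorem. On these the third sum is a unit times \<open>2\<close>, respectively times \<open>a + c - b\<close>, and where
  it vanishes the fourth does not. A vertex is determined by a neighbour and its leading
  coordinate, so for distinctness of consecutive vertices it suffices that \<open>u\<^sub>i, v\<^sub>i \<noteq> 0\<close>; the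
  absence of 4-cycles then yields all other inequalities in an 8-cycle.
\<close>

section \<open>Adjacency and its coordinate equations\<close>

definition adj :: "nat \<Rightarrow> 'a::field vec \<Rightarrow> 'a vec \<Rightarrow> bool" where
  "adj k l r \<longleftrightarrow> l \<in> L_set k \<and> r \<in> R_set k \<and> incident k l r"

lemma edge_iff [simp]: "{Inl l, Inr r} \<in> snd (Lambda_graph k) \<longleftrightarrow> adj k l r"
  by (auto simp: Lambda_graph_def adj_def doubleton_eq_iff)

lemma edge_iff' [simp]: "{Inr r, Inl l} \<in> snd (Lambda_graph k) \<longleftrightarrow> adj k l r"
  by (simp add: insert_commute)

lemma edge_isl_neq: "{a, b} \<in> snd (Lambda_graph k) \<Longrightarrow> isl a \<noteq> isl b"
  by (auto simp: Lambda_graph_def doubleton_eq_iff)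

lemma adj_coord2:
  assumes "adj k l r" "2 \<le> k"
  shows "l $ 2 + r $ 2 = r $ 0 * l $ 0"
  using assms bspec[of "{2..k}" _ 2] by (force simp: adj_def incident_def)

lemma adj_coord3:
  assumes "adj k l r" "3 \<le> k"
  shows "l $ 3 + r $ 3 = r $ 0 * l $ 2"
proof -
  have "l $ 3 + r $ 3 = r $ 0 * l $ (3 - 2)"
    using assms unfolding adj_def incident_def by force
  then show ?thesis using assms by (simp add: adj_def L_set_def)
qed

lemma adj_coord4:
  assumes "adj k l r" "4 \<le> k"
  shows "l $ 4 + r $ 4 = l $ 0 * r $ 2"
proof -
  have "l $ 4 + r $ 4 = l $ 0 * r $ (4 - 2)"
    using assms unfolding adj_def incident_def by force
  then show ?thesis by simp
qed

lemma adj_coord5: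
  assumes "adj k l r" "5 \<le> k"
  shows "l $ 5 + r $ 5 = l $ 0 * r $ 3"
proof -
  have "l $ 5 + r $ 5 = l $ 0 * r $ (5 - 2)"
    using assms unfolding adj_def incident_def by force
  then show ?thesis by simp
qed

lemma adj_step:
  assumes "adj k l r" "2 \<le> i" "i \<le> k"
  shows "l $ i + r $ i = (if i mod 4 \<in> {2, 3} then r $ 0 * l $ (i - 2) else l $ 0 * r $ (i - 2))"
proof -
  have "i mod 4 \<in> {2,3} \<or> i mod 4 \<in> {0,1}" by (simp, presburger)
  then show ?thesis using assms unfolding adj_def incident_def by auto
qed

text \<open>With \<open>r\<close> and \<open>l $ 0\<close> known, each equation gives
  \<open>l $ i\<close> from \<open>l $ (i - 2)\<close>. Odd coordinates start from
  \<open>l $ 1\<close>, which no equation yields directly; it is recovered from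
  \<open>l $ 1 = l $ 2\<close>, so coordinate 2 is treated first.\<close>

lemma adj_right_unique:
  assumes "adj k l r" "adj k l' r" "l $ 0 = l' $ 0" "2 \<le> k"
  shows "l = l'"
proof (rule eq_vecI)
  show "dim_vec l = dim_vec l'" using assms by (auto simp: adj_def L_set_def)
  have 2: "l $ 2 = l' $ 2"
    using adj_coord2[OF assms(1,4)] adj_coord2[OF assms(2,4)] assms(3) by (metis add_right_cancel)
  then have 1: "l $ 1 = l' $ 1" using assms by (simp add: adj_def L_set_def)
  have "i \<le> k \<Longrightarrow> l $ i = l' $ i" for i
  proof (induction i rule: less_induct)
    case (less i)
    show ?case
    proof (cases "i < 2")
      case True
      then have "i = 0 \<or> i = 1" by auto
      then show ?thesis using assms(3) 1 by auto
    next
      case False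
      then have "l $ (i - 2) = l' $ (i - 2)" using less by simp
      then show ?thesis
        using adj_step[OF assms(1), of i] adj_step[OF assms(2), of i] False less.prems assms(3)
        by (metis add_right_cancel not_less)
    qed
  qed
  then show "l $ i = l' $ i" if "i < dim_vec l'" for i
    using that assms(2) by (auto simp: adj_def L_set_def)
qed

lemma adj_left_unique:
  assumes "adj k l r" "adj k l r'" "r $ 0 = r' $ 0"
  shows "r = r'"
proof (rule eq_vecI)
  show "dim_vec r = dim_vec r'" using assms by (auto simp: adj_def R_set_def)
  have 1: "r $ 1 = r' $ 1" using assms by (simp add: adj_def R_set_def)
  have "i \<le> k \<Longrightarrow> r $ i = r' $ i" for i
  proof (induction i rule: less_induct)
    case (less i)
    show ?case
    proof (cases "i < 2")
      case True
      then have "i = 0 \<or> i = 1" by auto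
      then show ?thesis using assms(3) 1 by auto
    next
      case False
      then have "r $ (i - 2) = r' $ (i - 2)" using less by simp
      then show ?thesis
        using adj_step[OF assms(1), of i] adj_step[OF assms(2), of i] False less.prems assms(3)
        by (metis add_left_cancel not_less)
    qed
  qed
  then show "r $ i = r' $ i" if "i < dim_vec r'" for i
    using that assms(2) by (auto simp: adj_def R_set_def)
qed

section \<open>Closed walks and the sums attached to them\<close>

text \<open>These are non-backtracking closed walks, a weaker notion than cycles. Repeating the
  start at index \<open>m\<close> avoids modular arithmetic and makes telescoping immediate.\<close>

definition closed_walk ::
    "nat \<Rightarrow> nat \<Rightarrow> (nat \<Rightarrow> 'a::field vec) \<Rightarrow> (nat \<Rightarrow> 'a vec) \<Rightarrow> bool" where
  "closed_walk k m l r \<longleftrightarrow>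
     (\<forall>j \<le> m. adj k (l j) (r j)) \<and> (\<forall>j < m. adj k (l (Suc j)) (r j)) \<and>
     l m = l 0 \<and> r m = r 0 \<and> (\<forall>j < m. l (Suc j) \<noteq> l j \<and> r (Suc j) \<noteq> r j)"

lemma closed_walk_neq:
  assumes "closed_walk k m l r" "2 \<le> k" "j < m"
  shows "l (Suc j) $ 0 \<noteq> l j $ 0" "r (Suc j) $ 0 \<noteq> r j $ 0"
proof -
  have a: "adj k (l j) (r j)" "adj k (l (Suc j)) (r j)" "adj k (l (Suc j)) (r (Suc j))"
    and n: "l (Suc j) \<noteq> l j" "r (Suc j) \<noteq> r j"
    using assms unfolding closed_walk_def by auto
  show "l (Suc j) $ 0 \<noteq> l j $ 0" using adj_right_unique[OF a(2,1)] n assms by auto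
  show "r (Suc j) $ 0 \<noteq> r j $ 0" using adj_left_unique[OF a(3,2)] n by auto
qed

text \<open>Subtracting the incidence equations of two edges that share a vertex cancels that
  vertex's own coordinate. For coordinate 3 of \<open>l\<close> the increment of
  \<open>l $ 2\<close> is then substituted, which produces the square.\<close>

lemma closed_walk_step:
  assumes "closed_walk k m l r" "j < m"
  shows
    "2 \<le> k \<Longrightarrow> l (Suc j) $ 2 - l j $ 2 = r j $ 0 * (l (Suc j) $ 0 - l j $ 0)"
    "2 \<le> k \<Longrightarrow> r (Suc j) $ 2 - r j $ 2 = l (Suc j) $ 0 * (r (Suc j) $ 0 - r j $ 0)"
    "3 \<le> k \<Longrightarrow> l (Suc j) $ 3 - l j $ 3 = (r j $ 0)\<^sup>2 * (l (Suc j) $ 0 - l j $ 0)"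
    "3 \<le> k \<Longrightarrow> r (Suc j) $ 3 - r j $ 3 = l (Suc j) $ 2 * (r (Suc j) $ 0 - r j $ 0)"
    "4 \<le> k \<Longrightarrow> l (Suc j) $ 4 - l j $ 4 = r j $ 2 * (l (Suc j) $ 0 - l j $ 0)"
    "5 \<le> k \<Longrightarrow> l (Suc j) $ 5 - l j $ 5 = r j $ 3 * (l (Suc j) $ 0 - l j $ 0)"
proof -
  have a: "adj k (l j) (r j)" "adj k (l (Suc j)) (r j)" "adj k (l (Suc j)) (r (Suc j))"
    using assms unfolding closed_walk_def by auto
  note c2 = a[THEN adj_coord2] and c3 = a[THEN adj_coord3]
    and c4 = a[THEN adj_coord4] and c5 = a[THEN adj_coord5]
  show 2: "l (Suc j) $ 2 - l j $ 2 = r j $ 0 * (l (Suc j) $ 0 - l j $ 0)" if "2 \<le> k"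
    using c2(1,2)[OF that] by Groebner_Basis.algebra
  show "r (Suc j) $ 2 - r j $ 2 = l (Suc j) $ 0 * (r (Suc j) $ 0 - r j $ 0)" if "2 \<le> k"
    using c2(2,3)[OF that] by Groebner_Basis.algebra
  show "l (Suc j) $ 3 - l j $ 3 = (r j $ 0)\<^sup>2 * (l (Suc j) $ 0 - l j $ 0)" if "3 \<le> k"
    proof -
    have "l (Suc j) $ 2 - l j $ 2 = r j $ 0 * (l (Suc j) $ 0 - l j $ 0)" using 2 that by simp
    then show ?thesis using c3(1,2)[OF that] by Groebner_Basis.algebra
  qed
  show "r (Suc j) $ 3 - r j $ 3 = l (Suc j) $ 2 * (r (Suc j) $ 0 - r j $ 0)" if "3 \<le> k"
    using c3(2,3)[OF that] by Groebner_Basis.algebra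
  show "l (Suc j) $ 4 - l j $ 4 = r j $ 2 * (l (Suc j) $ 0 - l j $ 0)" if "4 \<le> k"
    using c4(1,2)[OF that] by Groebner_Basis.algebra
  show "l (Suc j) $ 5 - l j $ 5 = r j $ 3 * (l (Suc j) $ 0 - l j $ 0)" if "5 \<le> k"
    using c5(1,2)[OF that] by Groebner_Basis.algebra
qed

lemma sum_by_parts_cyclic:
  fixes x q :: "nat \<Rightarrow> 'a::comm_ring_1"
  assumes "x m = x 0" "q m = q 0" "(\<Sum>j<m. q j * (x (Suc j) - x j)) = 0"
  shows "(\<Sum>j<m. x (Suc j) * (q (Suc j) - q j)) = 0"
proof -
  have "(\<Sum>j<m. x (Suc j) * (q (Suc j) - q j)) + (\<Sum>j<m. q j * (x (Suc j) - x j))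
      = (\<Sum>j<m. x (Suc j) * q (Suc j) - x j * q j)"
    by (simp add: sum.distrib[symmetric] algebra_simps)
  also have "\<dots> = 0"
    using sum_lessThan_telescope[of "\<lambda>j. x j * q j" m] assms by simp
  finally show ?thesis using assms by simp
qed

lemma closed_walk_sums:
  assumes "closed_walk k m l r"
  shows
    "2 \<le> k \<Longrightarrow> (\<Sum>j<m. r j $ 0 * (l (Suc j) $ 0 - l j $ 0)) = 0"
    "3 \<le> k \<Longrightarrow> (\<Sum>j<m. (r j $ 0)\<^sup>2 * (l (Suc j) $ 0 - l j $ 0)) = 0"
    "4 \<le> k \<Longrightarrow> (\<Sum>j<m. (l (Suc j) $ 0)\<^sup>2 * (r (Suc j) $ 0 - r j $ 0)) = 0"
    "5 \<le> k \<Longrightarrow> (\<Sum>j<m. l (Suc j) $ 0 * (l (Suc j) $ 2 * (r (Suc j) $ 0 - r j $ 0))) = 0"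
proof -
  note step = closed_walk_step[OF assms]
  have cl: "l m = l 0" "r m = r 0" using assms by (auto simp: closed_walk_def)
  have tel: "(\<Sum>j<m. l (Suc j) $ i - l j $ i) = 0" for i
    using sum_lessThan_telescope[of "\<lambda>j. l j $ i" m] cl by simp
  show "(\<Sum>j<m. r j $ 0 * (l (Suc j) $ 0 - l j $ 0)) = 0" if "2 \<le> k"
    using tel[of 2] step(1) that by simp
  show "(\<Sum>j<m. (r j $ 0)\<^sup>2 * (l (Suc j) $ 0 - l j $ 0)) = 0" if "3 \<le> k"
    using tel[of 3] step(3) that by simp
  show "(\<Sum>j<m. (l (Suc j) $ 0)\<^sup>2 * (r (Suc j) $ 0 - r j $ 0)) = 0" if k: "4 \<le> k"
  proof -
    \<comment> \<open>The factor \<open>r j $ 2\<close> is known only through its increments, so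
      summation by parts moves the difference onto it; coordinate 5 below is treated
      likewise.\<close>
    have "(\<Sum>j<m. r j $ 2 * (l (Suc j) $ 0 - l j $ 0)) = 0"
      using tel[of 4] step(5) k by simp
    from sum_by_parts_cyclic[of "\<lambda>j. l j $ 0" m "\<lambda>j. r j $ 2", OF _ _ this] cl
    show ?thesis using step(2) k by (simp add: power2_eq_square mult.assoc)
  qed
  show "(\<Sum>j<m. l (Suc j) $ 0 * (l (Suc j) $ 2 * (r (Suc j) $ 0 - r j $ 0))) = 0" if k: "5 \<le> k"
  proof -
    have "(\<Sum>j<m. r j $ 3 * (l (Suc j) $ 0 - l j $ 0)) = 0"
      using tel[of 5] step(6) k by simp
    from sum_by_parts_cyclic[of "\<lambda>j. l j $ 0" m "\<lambda>j. r j $ 3", OF _ _ this] cl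
    show ?thesis using step(4) k by simp
  qed
qed

section \<open>Closed walks of length 4, 6 and 8\<close>

lemma no_closed_walk_2:
  assumes "2 \<le> k"
  shows "\<not> closed_walk k 2 l r"
proof
  assume w: "closed_walk k 2 l r"
  have n: "l 1 $ 0 \<noteq> l 0 $ 0" "r 1 $ 0 \<noteq> r 0 $ 0"
    using closed_walk_neq[OF w assms, of 0] by auto
  have cl: "l 2 = l 0" using w by (auto simp: closed_walk_def)
  have "(r 1 $ 0 - r 0 $ 0) * (l 1 $ 0 - l 0 $ 0) = 0"
    using closed_walk_sums(1)[OF w assms] cl
    by (simp add: numeral_2_eq_2 algebra_simps)
  then show False using n by auto
qed

lemma no_closed_walk_3:
  assumes "3 \<le> k"
  shows "\<not> closed_walk k 3 l r"
proof
  assume w: "closed_walk k 3 l r"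
  have cl: "l 3 = l 0" "r 3 = r 0" using w by (auto simp: closed_walk_def)
  have n: "l 1 $ 0 \<noteq> l 0 $ 0" "r 1 $ 0 \<noteq> r 0 $ 0" "r 2 $ 0 \<noteq> r 1 $ 0" "r 0 $ 0 \<noteq> r 2 $ 0"
    using closed_walk_neq[OF w, of 0] closed_walk_neq[OF w, of 1] closed_walk_neq[OF w, of 2] assms cl
    by (auto simp: numeral_eq_Suc)
  define x0 x1 x2 y0 y1 y2 where d: "x0 = l 0 $ 0" "x1 = l 1 $ 0" "x2 = l 2 $ 0"
    "y0 = r 0 $ 0" "y1 = r 1 $ 0" "y2 = r 2 $ 0"
  have e1: "y0 * (x1 - x0) + y1 * (x2 - x1) + y2 * (x0 - x2) = 0"
    using closed_walk_sums(1)[OF w] assms cl unfolding d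
    by (simp add: eval_nat_numeral)
  have e2: "y0^2 * (x1 - x0) + y1^2 * (x2 - x1) + y2^2 * (x0 - x2) = 0"
    using closed_walk_sums(2)[OF w] assms cl unfolding d
    by (simp add: eval_nat_numeral)
  \<comment> \<open>This is the sum of \<open>(y_i - y1) * (y_i - y2) * u_i\<close>, a combination
    of \<open>e1\<close>, \<open>e2\<close> and the vanishing sum of the \<open>u_i\<close>; only
    the term \<open>i = 0\<close> survives.\<close>
  have "(y2 - y0) * (y1 - y0) * (x1 - x0) = 0" using e1 e2 by Groebner_Basis.algebra
  then show False using n d by auto
qed

text \<open>
  All these sums are invariant under translating the \<open>x\<^sub>i\<close> and the \<open>y\<^sub>i\<close>, so they can be expressed in
  the increments alone although the walk need not start at the zero vectors.
\<close>

lemma closed_walk_4_eqs: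
  assumes w: "closed_walk k 4 l r" and k: "3 \<le> k"
    and u: "u1 = l 1 $ 0 - l 0 $ 0" "u2 = l 2 $ 0 - l 1 $ 0"
           "u3 = l 3 $ 0 - l 2 $ 0" "u4 = l 0 $ 0 - l 3 $ 0"
    and v: "v1 = r 1 $ 0 - r 0 $ 0" "v2 = r 2 $ 0 - r 1 $ 0"
           "v3 = r 3 $ 0 - r 2 $ 0" "v4 = r 0 $ 0 - r 3 $ 0"
  shows "0 \<notin> set [u1, v1, u2, v2, u3, v3, u4, v4]"
    and "u1 + u2 + u3 + u4 = 0" "v1 + v2 + v3 + v4 = 0"
    and "v1 * u2 + (v1 + v2) * u3 - v4 * u4 = 0"
    and "v1\<^sup>2 * u2 + (v1 + v2)\<^sup>2 * u3 + v4\<^sup>2 * u4 = 0"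
    and "4 \<le> k \<Longrightarrow> u1\<^sup>2 * v1 + (u1 + u2)\<^sup>2 * v2 + u4\<^sup>2 * v3 = 0"
    and "5 \<le> k \<Longrightarrow> (u1 + u2) * (v1 * u2) * v2 - u4 * (v4 * u4) * v3 = 0"
proof -
  have cl: "l 4 = l 0" "r 4 = r 0" using w by (auto simp: closed_walk_def)
  have sum4: "(\<Sum>j<4. f j) = f 0 + f 1 + f 2 + f 3" for f :: "nat \<Rightarrow> 'a"
    by (simp add: eval_nat_numeral)
  have S: "Suc 2 = 3" "Suc 3 = 4" by simp_all
  have k2: "2 \<le> k" using k by simp
  note ne = closed_walk_neq[OF w k2]
  show "0 \<notin> set [u1, v1, u2, v2, u3, v3, u4, v4]"
    using ne[of 0] ne[of 1] ne[of 2] ne[of 3] cl unfolding u v by (auto simp: S numeral_2_eq_2[symmetric])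
  show s1: "u1 + u2 + u3 + u4 = 0" and s2: "v1 + v2 + v3 + v4 = 0"
    unfolding u v by simp_all
  define x0 x1 x2 x3 y0 y1 y2 y3 where d: "x0 = l 0 $ 0" "x1 = l 1 $ 0" "x2 = l 2 $ 0" "x3 = l 3 $ 0"
    "y0 = r 0 $ 0" "y1 = r 1 $ 0" "y2 = r 2 $ 0" "y3 = r 3 $ 0"
  note uv = u[folded d] v[folded d]
  have e1: "y0 * (x1 - x0) + y1 * (x2 - x1) + y2 * (x3 - x2) + y3 * (x0 - x3) = 0"
    using closed_walk_sums(1)[OF w] k cl unfolding d by (simp add: sum4 S numeral_2_eq_2[symmetric])
  have e2: "y0^2 * (x1 - x0) + y1^2 * (x2 - x1) + y2^2 * (x3 - x2) + y3^2 * (x0 - x3) = 0"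
    using closed_walk_sums(2)[OF w] k cl unfolding d by (simp add: sum4 S numeral_2_eq_2[symmetric])
  show "v1 * u2 + (v1 + v2) * u3 - v4 * u4 = 0"
    using e1 unfolding uv by Groebner_Basis.algebra
  show "v1\<^sup>2 * u2 + (v1 + v2)\<^sup>2 * u3 + v4\<^sup>2 * u4 = 0"
    using e1 e2 unfolding uv by Groebner_Basis.algebra
  have e4: "x1^2 * (y1 - y0) + x2^2 * (y2 - y1) + x3^2 * (y3 - y2) + x0^2 * (y0 - y3) = 0"
    if "4 \<le> k"
    using closed_walk_sums(3)[OF w] that cl unfolding d by (simp add: sum4 S numeral_2_eq_2[symmetric])
  show "u1\<^sup>2 * v1 + (u1 + u2)\<^sup>2 * v2 + u4\<^sup>2 * v3 = 0" if "4 \<le> k"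
    using e1 e4[OF that] unfolding uv by Groebner_Basis.algebra
  show "(u1 + u2) * (v1 * u2) * v2 - u4 * (v4 * u4) * v3 = 0" if k5: "5 \<le> k"
  proof -
    \<comment> \<open>The value \<open>p0\<close> is undetermined, but it enters the sum below only
      as a multiple of the sum of \<open>x\<close> times increments of \<open>y\<close>, which
      vanishes with \<open>e1\<close> by summation by parts. Computing \<open>l 3 $ 2\<close>
      backwards across the closing step gives the term in \<open>v4 * u4\<close>.\<close>
    define p0 where "p0 = l 0 $ 2"
    have "l 1 $ 2 - p0 = y0 * (x1 - x0)" "l 2 $ 2 - l 1 $ 2 = y1 * (x2 - x1)"
      "p0 - l 3 $ 2 = y3 * (x0 - x3)"
      using closed_walk_step(1)[OF w, of 0] closed_walk_step(1)[OF w, of 1]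
        closed_walk_step(1)[OF w, of 3] k cl unfolding d p0_def
      by (simp_all add: S numeral_2_eq_2[symmetric])
    then have p: "l 1 $ 2 = p0 + y0 * (x1 - x0)" "l 2 $ 2 = p0 + y0 * (x1 - x0) + y1 * (x2 - x1)"
      "l 3 $ 2 = p0 - y3 * (x0 - x3)"
      by Groebner_Basis.algebra+
    have "x1 * (l 1 $ 2 * (y1 - y0)) + x2 * (l 2 $ 2 * (y2 - y1))
        + x3 * (l 3 $ 2 * (y3 - y2)) + x0 * (p0 * (y0 - y3)) = 0"
      using closed_walk_sums(4)[OF w] k5 cl unfolding d p0_def
      by (simp add: sum4 S numeral_2_eq_2[symmetric])
    note e5 = this[unfolded p]
    have e4: "x1^2 * (y1 - y0) + x2^2 * (y2 - y1) + x3^2 * (y3 - y2) + x0^2 * (y0 - y3) = 0"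
      using e4 k5 by simp
    show ?thesis using e1 e2 e4 e5 unfolding uv by Groebner_Basis.algebra
  qed
qed

section \<open>Solving the equations in the increments\<close>

text \<open>The leading coordinate \<open>y\<close> returns to its start after two steps, so the
  \<open>u3\<close> terms drop. Inserting \<open>v1 * u2 = v4 * u4\<close> into the quadratic
  equation leaves \<open>v1 * u2 * (v1 + v4) = 0\<close>.\<close>

lemma parallel_type:
  fixes u1 :: "'a::field"
  assumes nz: "0 \<notin> set [u1, v1, u2, v2, u3, v3, u4, v4]" and z: "v1 + v2 = 0"
  shows "u1 + u2 + u3 + u4 = 0 \<and> v1 + v2 + v3 + v4 = 0 \<and>
      v1 * u2 + (v1 + v2) * u3 - v4 * u4 = 0 \<and> v1\<^sup>2 * u2 + (v1 + v2)\<^sup>2 * u3 + v4\<^sup>2 * u4 = 0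
    \<longleftrightarrow> u3 = - u1 \<and> u4 = - u2 \<and> v2 = - v1 \<and> v3 = v1 \<and> v4 = - v1" (is "?L \<longleftrightarrow> ?R")
proof
  assume L: ?L
  have a: "v1 * u2 = v4 * u4" "v1\<^sup>2 * u2 + v4\<^sup>2 * u4 = 0" using L z by auto
  then have "v1 * u2 * (v1 + v4) = 0" by Groebner_Basis.algebra
  then have v4: "v4 = - v1" using nz by (simp add: add_eq_0_iff)
  then have "v1 * (u2 + u4) = 0" using a by (simp add: algebra_simps)
  then have u4: "u4 = - u2" using nz by (simp add: add_eq_0_iff)
  have v2: "v2 = - v1" using z by (simp add: add_eq_0_iff)
  show ?R using L u4 v4 v2 by (auto simp: add_eq_0_iff)
next
  assume ?R then show ?L by simp
qed

text \<open>Here \<open>a\<close>, \<open>b\<close>, \<open>c\<close> are the later values of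
  \<open>y\<close> relative to the first. Once they are distinct and nonzero, the last two
  equations, linear in \<open>(u2, u3, u4)\<close>, have as solutions the multiples of the cross
  product of \<open>(a, b, c)\<close> and \<open>(a^2, b^2, c^2)\<close>; \<open>t\<close> is the
  multiplier.\<close>

lemma generic_type:
  fixes u1 :: "'a::field"
  assumes nz: "0 \<notin> set [u1, v1, u2, v2, u3, v3, u4, v4]" and z: "v1 + v2 \<noteq> 0"
  assumes e: "u1 + u2 + u3 + u4 = 0" "v1 + v2 + v3 + v4 = 0"
      "v1 * u2 + (v1 + v2) * u3 - v4 * u4 = 0" "v1\<^sup>2 * u2 + (v1 + v2)\<^sup>2 * u3 + v4\<^sup>2 * u4 = 0"
  obtains t a b c where "t \<noteq> 0" "a \<noteq> 0" "b \<noteq> 0" "c \<noteq> 0" "distinct [a, b, c]"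
    "v1 = a" "v2 = b - a" "v3 = c - b" "v4 = - c"
    "u2 = t * b * c * (c - b)" "u3 = t * a * c * (a - c)" "u4 = t * a * b * (b - a)"
    "u1 = t * (c - b) * (a - c) * (b - a)"
proof -
  define a b c where abc: "a = v1" "b = v1 + v2" "c = - v4"
  have v: "v1 = a" "v2 = b - a" "v4 = - c" by (auto simp: abc)
  have v3: "v3 = c - b" using e(2) unfolding v by Groebner_Basis.algebra
  have n: "a \<noteq> 0" "b \<noteq> 0" "c \<noteq> 0" "b \<noteq> a" "c \<noteq> b" using nz z v v3 by auto
  have f: "a * u2 + b * u3 + c * u4 = 0" "a\<^sup>2 * u2 + b\<^sup>2 * u3 + c\<^sup>2 * u4 = 0"
    using e(3,4) unfolding v by simp_all
  have h3: "b * (b - c) * u3 = a * (c - a) * u2" using f by Groebner_Basis.algebra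
  have h4: "c * (c - b) * u4 = a * (b - a) * u2" using f by Groebner_Basis.algebra
  \<comment> \<open>If \<open>a = c\<close>, then \<open>h3\<close> would force
    \<open>u3 = 0\<close>.\<close>
  have ac: "a \<noteq> c" using h3 n nz by auto
  define t where "t = u2 / (b * c * (c - b))"
  have u2: "u2 = t * b * c * (c - b)" using n unfolding t_def by simp
  have t0: "t \<noteq> 0" using nz n unfolding t_def by simp
  have "b * (b - c) * (u3 - t * a * c * (a - c)) = 0" using h3 u2 by Groebner_Basis.algebra
  then have u3: "u3 = t * a * c * (a - c)" using n by simp
  have "c * (c - b) * (u4 - t * a * b * (b - a)) = 0" using h4 u2 by Groebner_Basis.algebra
  then have u4: "u4 = t * a * b * (b - a)" using n by simp
  have "u1 = t * (c - b) * (a - c) * (b - a)" using e(1) u2 u3 u4 by Groebner_Basis.algebra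
  with v v3 n ac u2 u3 u4 t0 that[of t a b c] show thesis by auto
qed

text \<open>Converse of \<open>generic_type\<close>. The last identity isolates the obstruction in
  coordinate 4: for \<open>t\<close> nonzero and \<open>a\<close>, \<open>b\<close>,
  \<open>c\<close> nonzero and distinct, only the factor \<open>a + c - b\<close> can
  vanish.\<close>

lemma generic_type_eqs:
  fixes t :: "'a::field"
  assumes "v1 = a" "v2 = b - a" "v3 = c - b" "v4 = - c"
    "u2 = t * b * c * (c - b)" "u3 = t * a * c * (a - c)" "u4 = t * a * b * (b - a)"
    "u1 = t * (c - b) * (a - c) * (b - a)"
  shows "u1 + u2 + u3 + u4 = 0" "v1 + v2 + v3 + v4 = 0"
      "v1 * u2 + (v1 + v2) * u3 - v4 * u4 = 0" "v1\<^sup>2 * u2 + (v1 + v2)\<^sup>2 * u3 + v4\<^sup>2 * u4 = 0"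
    "u1\<^sup>2 * v1 + (u1 + u2)\<^sup>2 * v2 + u4\<^sup>2 * v3
      = t\<^sup>2 * a * b * c * (c - b) * (b - a) * (c - a) * (a + c - b)"
  unfolding assms by Groebner_Basis.algebra+

text \<open>Where coordinate 4 closes up, coordinate 5 does not: the product is nonzero for
  \<open>t\<close> nonzero and \<open>a\<close>, \<open>b\<close>, \<open>c\<close> nonzero and
  distinct.\<close>

lemma generic_type_coord5:
  fixes t :: "'a::field"
  assumes "v1 = a" "v2 = b - a" "v3 = c - b" "v4 = - c"
    "u2 = t * b * c * (c - b)" "u3 = t * a * c * (a - c)" "u4 = t * a * b * (b - a)"
    "u1 = t * (c - b) * (a - c) * (b - a)" "a + c = b"
  shows "(u1 + u2) * (v1 * u2) * v2 - u4 * (v4 * u4) * v3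
    = t\<^sup>2 * a\<^sup>2 * b * c * (c - b) * (b - a) * (c * (c - a))"
proof -
  have b: "b = a + c" using assms by simp
  show ?thesis unfolding assms(1-8) b by Groebner_Basis.algebra
qed

section \<open>From cycles to closed walks; lower bounds for the girth\<close>

lemma no_quadrilateral:
  assumes "adj k a r" "adj k b r" "adj k a s" "adj k b s" "2 \<le> k"
  shows "a = b \<or> r = s"
proof (rule ccontr)
  assume "\<not> (a = b \<or> r = s)"
  then have "closed_walk k 2 (\<lambda>j. if j = 1 then b else a) (\<lambda>j. if j = 1 then s else r)"
    using assms by (auto simp: closed_walk_def less_2_cases_iff)
  then show False using no_closed_walk_2 assms by blast
qed

text \<open>A vertex list may begin on either side. It is extended periodically and shifted to begin
  in \<open>L_set k\<close>; sides alternate along edges, so the period is even.\<close>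

lemma cycle_closed_walk:
  fixes c :: "('a::field vec + 'a vec) list"
  assumes c: "is_cycle (Lambda_graph k) c"
  obtains m and l r :: "nat \<Rightarrow> 'a vec" where "length c = 2 * m" "closed_walk k m l r"
proof -
  define n where "n = length c"
  have n3: "3 \<le> n" and dc: "distinct c"
    using c by (auto simp: is_cycle_def n_def)
  have E: "{c ! i, c ! (Suc i mod n)} \<in> snd (Lambda_graph k)" if "i < n" for i
    using c that by (auto simp: is_cycle_def n_def)
  define s :: nat where "s = (if isl (c ! 0) then 0 else 1)"
  define d where "d i = c ! ((i + s) mod n)" for i
  have edge: "{d i, d (Suc i)} \<in> snd (Lambda_graph k)" for i
    using E[of "(i + s) mod n"] n3 by (simp add: d_def mod_Suc_eq)
  have "isl (d 0)"
    using E[of 0, THEN edge_isl_neq] n3 by (auto simp: d_def s_def)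
  moreover have "isl (d (Suc i)) \<longleftrightarrow> \<not> isl (d i)" for i
    using edge_isl_neq[OF edge[of i]] by blast
  ultimately have colour: "isl (d i) \<longleftrightarrow> even i" for i
    by (induction i) simp_all
  have per: "d (n + i) = d i" for i
    using n3 by (simp add: d_def add.assoc)
  have "even n" using per[of 0] colour[of n] colour[of 0] by simp
  then obtain m where m: "n = 2 * m" by (elim evenE)
  define l r where "l j = projl (d (2 * j))" and "r j = projr (d (2 * j + 1))" for j
  have dl: "d (2 * j) = Inl (l j)" and dr: "d (Suc (2 * j)) = Inr (r j)" for j
    using colour[of "2 * j"] colour[of "Suc (2 * j)"] by (auto simp: l_def r_def sum.expand)
  \<comment> \<open>Vertices two apart differ because the cycle length, at least 3, does not divide
    2.\<close>
  have neq: "d (Suc (Suc i)) \<noteq> d i" for i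
  proof
    assume "d (Suc (Suc i)) = d i"
    then have "(i + 2 + s) mod n = (i + s) mod n"
      using dc n3 by (simp add: d_def nth_eq_iff_index_eq n_def[symmetric])
    then have "n dvd 2"
      by (subst (asm) mod_eq_dvd_iff_nat) auto
    then show False using n3 by (auto dest: dvd_imp_le)
  qed
  have "closed_walk k m l r"
    unfolding closed_walk_def
  proof (intro conjI allI impI)
    show "adj k (l j) (r j)" for j using edge[of "2 * j"] dl dr by simp
    show "adj k (l (Suc j)) (r j)" for j
      using edge[of "Suc (2 * j)"] dl[of "Suc j"] dr[of j] by simp
    show "l m = l 0" "r m = r 0"
      using per[of 0] per[of 1] dl[of m] dl[of 0] dr[of m] dr[of 0] m by simp_all
    show "l (Suc j) \<noteq> l j" for j using neq[of "2 * j"] dl[of j] dl[of "Suc j"] by simp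
    show "r (Suc j) \<noteq> r j" for j using neq[of "Suc (2 * j)"] dr[of j] dr[of "Suc j"] by simp
  qed
  then show thesis using m n_def by (intro that[of m l r]) simp_all
qed

lemma cycle_length_cases:
  assumes "is_cycle (Lambda_graph k) (c :: ('a::field vec + 'a vec) list)" "3 \<le> k"
  shows "10 \<le> length c \<or> (length c = 8 \<and> (\<exists>l r :: nat \<Rightarrow> 'a vec. closed_walk k 4 l r))"
proof -
  obtain m and l r :: "nat \<Rightarrow> 'a vec" where m: "length c = 2 * m" "closed_walk k m l r"
    using cycle_closed_walk assms(1) by blast
  have "m \<noteq> 2" "m \<noteq> 3" using no_closed_walk_2[of k l r] no_closed_walk_3[of k l r] m assms(2) by auto
  moreover have "3 \<le> length c" using assms by (simp add: is_cycle_def)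
  ultimately have "m = 4 \<or> 5 \<le> m" using m by linarith
  then show ?thesis using m by auto
qed

lemma girth_ge_8:
  assumes "3 \<le> k"
  shows "8 \<le> girth (Lambda_graph k :: ('a::field vec + 'a vec) ugraph)"
  unfolding girth_def
proof (rule INF_greatest)
  fix c :: "('a vec + 'a vec) list" assume "c \<in> {c. is_cycle (Lambda_graph k) c}"
  then have "8 \<le> length c" using cycle_length_cases[of k c] assms by auto
  then show "8 \<le> enat (length c)" by (simp add: numeral_eq_enat)
qed

lemma girth_ge_10:
  assumes "3 \<le> k" "\<And>l r :: nat \<Rightarrow> 'a vec. \<not> closed_walk k 4 l r"
  shows "10 \<le> girth (Lambda_graph k :: ('a::field vec + 'a vec) ugraph)"
  unfolding girth_def
proof (rule INF_greatest)
  fix c :: "('a vec + 'a vec) list" assume "c \<in> {c. is_cycle (Lambda_graph k) c}"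
  then have "10 \<le> length c" using cycle_length_cases[of k c] assms by auto
  then show "10 \<le> enat (length c)" by (simp add: numeral_eq_enat)
qed

section \<open>Eight-cycles and their types\<close>

lemma length_cycle_type: "length (cycle_type ls rs) = 2 * length ls"
  by (simp add: cycle_type_def Let_def length_concat comp_def sum_list_triv)

lemma interleave_4:
  "interleave [l1, l2, l3, l4] [r1, r2, r3, r4]
    = [Inl l1, Inr r1, Inl l2, Inr r2, Inl l3, Inr r3, Inl l4, Inr r4]"
  by (simp add: interleave_def)

lemma cycle_type_4:
  "cycle_type [l1, l2, l3, l4] [r1, r2, r3, r4]
    = [l2 $ 0 - l1 $ 0, r2 $ 0 - r1 $ 0, l3 $ 0 - l2 $ 0, r3 $ 0 - r2 $ 0,
       l4 $ 0 - l3 $ 0, r4 $ 0 - r3 $ 0, - l4 $ 0, - r4 $ 0]"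
  by (simp add: cycle_type_def Let_def upt_rec)

lemma is_cycle_8_iff:
  assumes "2 \<le> k"
  shows "is_cycle (Lambda_graph k) [Inl l1, Inr r1, Inl l2, Inr r2, Inl l3, Inr r3, Inl l4, Inr r4]
    \<longleftrightarrow> (adj k l1 r1 \<and> adj k l2 r1 \<and> adj k l2 r2 \<and> adj k l3 r2 \<and> adj k l3 r3 \<and> adj k l4 r3 \<and>
      adj k l4 r4 \<and> adj k l1 r4) \<and>
      l1 \<noteq> l2 \<and> l2 \<noteq> l3 \<and> l3 \<noteq> l4 \<and> l4 \<noteq> l1 \<and> r1 \<noteq> r2 \<and> r2 \<noteq> r3 \<and> r3 \<noteq> r4 \<and> r4 \<noteq> r1"
    (is "is_cycle _ ?c \<longleftrightarrow> ?A \<and> ?N")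
proof -
  have less8: "(\<forall>i<8. P i) \<longleftrightarrow> P 0 \<and> P 1 \<and> P 2 \<and> P 3 \<and> P 4 \<and> P 5 \<and> P 6 \<and> P 7" for P :: "nat \<Rightarrow> bool"
    by (auto simp: eval_nat_numeral All_less_Suc)
  have len: "length ?c = 8" by simp
  have edges: "(\<forall>i < length ?c. {?c ! i, ?c ! (Suc i mod length ?c)} \<in> snd (Lambda_graph k))
      \<longleftrightarrow> ?A"
    by (simp only: len less8) simp
  have "set ?c \<subseteq> fst (Lambda_graph k)" if ?A
    using that by (auto simp: Lambda_graph_def adj_def)
  moreover have "distinct ?c \<longleftrightarrow> ?N" if A: ?A
  proof -
    \<comment> \<open>If opposite vertices on the same side coincided, they would close up a 4-cycle
      with the three vertices between them.\<close>
    have "l1 = l3 \<Longrightarrow> l1 = l2 \<or> r1 = r2" "r1 = r3 \<Longrightarrow> l2 = l3 \<or> r1 = r2"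
      "l2 = l4 \<Longrightarrow> l2 = l3 \<or> r2 = r3" "r2 = r4 \<Longrightarrow> l3 = l4 \<or> r2 = r3"
      using no_quadrilateral[OF _ _ _ _ assms] A by blast+
    then have "l1 \<noteq> l3 \<and> l2 \<noteq> l4 \<and> r1 \<noteq> r3 \<and> r2 \<noteq> r4" if ?N using that by blast
    then show ?thesis by auto
  qed
  moreover have "3 \<le> length ?c" by simp
  ultimately show ?thesis unfolding is_cycle_def edges by blast
qed

text \<open>The repeated \<open>p\<close> and the entry \<open>0\<close> build in membership in
  \<open>L_set k\<close> and \<open>R_set k\<close>. For \<open>k = 3\<close> the fifth list entry
  is cut off by \<open>vec\<close>, so one notation serves both values of \<open>k\<close>.\<close>

lemma adj_vec_iff:
  assumes "k = 3 \<or> k = 4"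
  shows "adj k (vec (k + 1) (\<lambda>i. [x, p, p, w, z] ! i)) (vec (k + 1) (\<lambda>i. [y, 0, q, w', z'] ! i))
    \<longleftrightarrow> p + q = y * x \<and> w + w' = y * p \<and> (k = 4 \<longrightarrow> z + z' = x * q)"
proof -
  have "{2..3} = {2, 3::nat}" "{2..4} = {2, 3, 4::nat}" by auto
  then show ?thesis using assms
    by (auto simp: adj_def L_set_def R_set_def incident_def)
qed

text \<open>For the converse, partial sums of the type prescribe the leading coordinates, and
  starting from the zero edge each incidence determines the next vertex. Only one edge is not
  incident by construction; the equations on the right supply it.\<close>

lemma has_cycle_of_type_8_iff:
  fixes u1 :: "'a::field"
  assumes k: "k = 3 \<or> k = 4" and nz: "0 \<notin> set [u1, v1, u2, v2, u3, v3, u4, v4]"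
  shows "has_cycle_of_type k [u1, v1, u2, v2, u3, v3, u4, v4] \<longleftrightarrow>
      (u1 + u2 + u3 + u4 = 0 \<and> v1 + v2 + v3 + v4 = 0 \<and>
       v1 * u2 + (v1 + v2) * u3 - v4 * u4 = 0 \<and> v1\<^sup>2 * u2 + (v1 + v2)\<^sup>2 * u3 + v4\<^sup>2 * u4 = 0) \<and>
      (k = 4 \<longrightarrow> u1\<^sup>2 * v1 + (u1 + u2)\<^sup>2 * v2 + u4\<^sup>2 * v3 = 0)" (is "?L \<longleftrightarrow> ?R")
proof
  assume ?L
  then obtain ls rs where len: "length ls = length rs"
    and cyc: "is_cycle (Lambda_graph k) (interleave ls rs)"
    and z: "ls ! 0 = 0\<^sub>v (k + 1)" "rs ! 0 = 0\<^sub>v (k + 1)"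
    and ty: "cycle_type ls rs = [u1, v1, u2, v2, u3, v3, u4, v4]"
    unfolding has_cycle_of_type_def by blast
  have "length ls = 4" using length_cycle_type[of ls rs] ty by simp
  then obtain l1 l2 l3 l4 r1 r2 r3 r4 where ls: "ls = [l1, l2, l3, l4]" and rs: "rs = [r1, r2, r3, r4]"
    using len by (auto simp: length_Suc_conv eval_nat_numeral)
  have k2: "2 \<le> k" "3 \<le> k" using k by auto
  note c = cyc[unfolded ls rs interleave_4 is_cycle_8_iff[OF k2(1)]]
  have w: "closed_walk k 4 (\<lambda>j. [l1, l2, l3, l4, l1] ! j) (\<lambda>j. [r1, r2, r3, r4, r1] ! j)"
    using c by (auto simp: closed_walk_def eval_nat_numeral less_Suc_eq_le[symmetric] All_less_Suc)
  have 0: "l1 $ 0 = 0" "r1 $ 0 = 0" using z ls rs by auto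
  note t = ty[unfolded ls rs cycle_type_4]
  show ?R
    using closed_walk_4_eqs[OF w k2(2), of u1 u2 u3 u4 v1 v2 v3 v4] t 0 by auto
next
  assume R: ?R
  define x2 x3 x4 where x: "x2 = u1" "x3 = u1 + u2" "x4 = u1 + u2 + u3"
  define y2 y3 y4 where y: "y2 = v1" "y3 = v1 + v2" "y4 = v1 + v2 + v3"
  \<comment> \<open>The digit numbers the vertex; coordinates 2, 3, 4 are \<open>p\<close>,
    \<open>w\<close>, \<open>t\<close> on the left and \<open>q\<close>, \<open>s\<close>,
    \<open>z\<close> on the right, each solved from the preceding vertex. Those not introduced are
    zero.\<close>
  define q2 z2 where 22: "q2 = y2 * x2" "z2 = x2 * q2"
  define p3 w3 t3 where 3: "p3 = y2 * x3 - q2" "w3 = y2 * p3" "t3 = x3 * q2 - z2"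
  define q3 s3 z3 where 33: "q3 = y3 * x3 - p3" "s3 = y3 * p3 - w3" "z3 = x3 * q3 - t3"
  define p4 w4 t4 where 4: "p4 = y3 * x4 - q3" "w4 = y3 * p4 - s3" "t4 = x4 * q3 - z3"
  define L where "L x p w z = vec (k + 1) (\<lambda>i. [x, p, p, w, z] ! i)" for x p w z :: 'a
  define Rv where "Rv y q w z = vec (k + 1) (\<lambda>i. [y, 0, q, w, z] ! i)" for y q w z :: 'a
  have a: "adj k (L x p w z) (Rv y q w' z')
      \<longleftrightarrow> p + q = y * x \<and> w + w' = y * p \<and> (k = 4 \<longrightarrow> z + z' = x * q)" for x p w z y q w' z'
    unfolding L_def Rv_def using k by (rule adj_vec_iff)
  have x4: "x4 = - u4" and y4: "y4 = - v4" using R x y by (auto simp: eq_neg_iff_add_eq_0)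
  \<comment> \<open>Adjacency to the zero vector forces the fourth right vertex to be
    \<open>Rv y4 0 0 0\<close>; these are the conditions for its edge to the fourth left
    vertex.\<close>
  have p4: "p4 = y4 * x4" "w4 = y4 * p4" "k = 4 \<Longrightarrow> t4 = 0"
  proof -
    have e: "u1 + u2 + u3 + u4 = 0" "v1 + v2 + v3 + v4 = 0"
       "v1 * u2 + (v1 + v2) * u3 - v4 * u4 = 0" "v1\<^sup>2 * u2 + (v1 + v2)\<^sup>2 * u3 + v4\<^sup>2 * u4 = 0"
      using R by auto
    show "p4 = y4 * x4" "w4 = y4 * p4"
      unfolding 4 33 3 22 x y using e by Groebner_Basis.algebra+
    show "t4 = 0" if "k = 4"
    proof -
      have "u1\<^sup>2 * v1 + (u1 + u2)\<^sup>2 * v2 + u4\<^sup>2 * v3 = 0" using R that by simp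
      then show ?thesis unfolding 4 33 3 22 x y using e by Groebner_Basis.algebra
    qed
  qed
  define ls where "ls = [L 0 0 0 0, L x2 0 0 0, L x3 p3 w3 t3, L x4 p4 w4 t4]"
  define rs where "rs = [Rv 0 0 0 0, Rv y2 q2 0 z2, Rv y3 q3 s3 z3, Rv y4 0 0 0]"
  have L0: "L x p w z $ 0 = x" "Rv x p w z $ 0 = x" for x p w z
    by (auto simp: L_def Rv_def)
  have zero: "L 0 0 0 0 = 0\<^sub>v (k + 1)" "Rv 0 0 0 0 = 0\<^sub>v (k + 1)"
    using k by (auto simp: L_def Rv_def less_Suc_eq eval_nat_numeral intro!: eq_vecI)
  have neq: "L x p w z \<noteq> L x' p' w' z'" "Rv x p w z \<noteq> Rv x' p' w' z'" if "x \<noteq> x'"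
    for x p w z x' p' w' z'
    using that L0 by metis+
  have adjs: "adj k (L 0 0 0 0) (Rv 0 0 0 0)" "adj k (L x2 0 0 0) (Rv 0 0 0 0)"
    "adj k (L x2 0 0 0) (Rv y2 q2 0 z2)" "adj k (L x3 p3 w3 t3) (Rv y2 q2 0 z2)"
    "adj k (L x3 p3 w3 t3) (Rv y3 q3 s3 z3)" "adj k (L x4 p4 w4 t4) (Rv y3 q3 s3 z3)"
    "adj k (L 0 0 0 0) (Rv y4 0 0 0)"
    unfolding a by (simp_all add: 22 3 33 4)
  have adj_last: "adj k (L x4 p4 w4 t4) (Rv y4 0 0 0)"
    unfolding a using p4 by simp
  have "is_cycle (Lambda_graph k) (interleave ls rs)"
    unfolding ls_def rs_def interleave_4
  proof (subst is_cycle_8_iff, goal_cases)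
    case 1 then show ?case using k by auto
  next
    case 2
    have "x2 \<noteq> 0" "x3 \<noteq> x2" "x4 \<noteq> x3" "x4 \<noteq> 0" "y2 \<noteq> 0" "y3 \<noteq> y2" "y4 \<noteq> y3" "y4 \<noteq> 0"
      using nz x4 y4 by (auto simp: x(1,2) y(1,2) x(3)[unfolded x(2)[symmetric]] y(3)[unfolded y(2)[symmetric]])
    then show ?case
      using adjs adj_last by (simp add: neq neq[symmetric])
  qed
  moreover have "cycle_type ls rs = [u1, v1, u2, v2, u3, v3, u4, v4]"
  proof -
    have "x4 - x3 = u3" "- x4 = u4" "y4 - y3 = v3" "- y4 = v4"
      subgoal by (simp add: x)
      subgoal by (simp add: x4)
      subgoal by (simp add: y)
      subgoal by (simp add: y4)
      done
    then show ?thesis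
      unfolding ls_def rs_def cycle_type_4 L0 by (simp add: x(1,2) y(1,2))
  qed
  ultimately show ?L
    unfolding has_cycle_of_type_def using zero
    by (intro exI[of _ ls] exI[of _ rs]) (auto simp: ls_def rs_def)
qed

lemma girth_le_8:
  assumes "has_cycle_of_type k [u1, v1, u2, v2, u3, v3, u4, v4 :: 'a]"
  shows "girth (Lambda_graph k :: ('a::field vec + 'a vec) ugraph) \<le> 8"
proof -
  obtain ls rs :: "'a vec list" where len: "length ls = length rs"
    and cyc: "is_cycle (Lambda_graph k) (interleave ls rs)"
    and ty: "cycle_type ls rs = [u1, v1, u2, v2, u3, v3, u4, v4]"
    using assms unfolding has_cycle_of_type_def by blast
  have "length (interleave ls rs) = 2 * length ls"
    using len by (induction rule: list_induct2) (auto simp: interleave_def)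
  also have "\<dots> = 8" using length_cycle_type[of ls rs] ty by simp
  finally have "enat (length (interleave ls rs)) = 8" by (simp add: numeral_eq_enat)
  moreover have "girth (Lambda_graph k :: ('a vec + 'a vec) ugraph) \<le> enat (length (interleave ls rs))"
    unfolding girth_def using cyc by (intro INF_lower) auto
  ultimately show ?thesis by simp
qed

section \<open>Obstructions from the size of the field and from coordinate 5\<close>

text \<open>The conclusion is shaped to be refuted in two ways: a field of three elements has no
  such triple, and \<open>k = 4\<close> fails for \<open>k = 5\<close>.\<close>

lemma closed_walk_4_generic:
  fixes l r :: "nat \<Rightarrow> 'a::field vec"
  assumes w: "closed_walk k 4 l r" and k: "4 \<le> k" and "(2::'a) \<noteq> 0 \<or> 5 \<le> k"
  obtains a b c :: 'a where "a \<noteq> 0" "b \<noteq> 0" "c \<noteq> 0" "distinct [a, b, c]" "k = 4"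
proof -
  define u1 u2 u3 u4 where u: "u1 = l 1 $ 0 - l 0 $ 0" "u2 = l 2 $ 0 - l 1 $ 0"
    "u3 = l 3 $ 0 - l 2 $ 0" "u4 = l 0 $ 0 - l 3 $ 0"
  define v1 v2 v3 v4 where v: "v1 = r 1 $ 0 - r 0 $ 0" "v2 = r 2 $ 0 - r 1 $ 0"
    "v3 = r 3 $ 0 - r 2 $ 0" "v4 = r 0 $ 0 - r 3 $ 0"
  have k3: "3 \<le> k" using k by simp
  note e = closed_walk_4_eqs[OF w k3 u v]
  show thesis
  proof (cases "v1 + v2 = 0")
    case True
    have t: "u3 = - u1" "u4 = - u2" "v2 = - v1" "v3 = v1" "v4 = - v1"
      using parallel_type[OF e(1) True] e(2-5) by auto
    have "2 * (u1 * v1 * u2) = 0"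
      using e(6)[OF k] unfolding t by Groebner_Basis.algebra
    \<comment> \<open>If \<open>2\<close> is nonzero, the last equation is already absurd; otherwise
      the assumption gives \<open>5 \<le> k\<close>, and coordinate 5 excludes this family in every
      characteristic.\<close>
    then have k5: "5 \<le> k" using assms(3) e(1) by auto
    have "u1 * v1\<^sup>2 * u2 = 0"
      using e(7)[OF k5] unfolding t by Groebner_Basis.algebra
    then show thesis using e(1) by auto
  next
    case False
    obtain t a b c where n: "t \<noteq> 0" "a \<noteq> 0" "b \<noteq> 0" "c \<noteq> 0" "distinct [a, b, c]"
      and eq: "v1 = a" "v2 = b - a" "v3 = c - b" "v4 = - c"
        "u2 = t * b * c * (c - b)" "u3 = t * a * c * (a - c)" "u4 = t * a * b * (b - a)"
        "u1 = t * (c - b) * (a - c) * (b - a)"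
      by (rule generic_type[OF e(1) False e(2-5)])
    have "a + c = b" using e(6)[OF k] n unfolding generic_type_eqs(5)[OF eq] by auto
    then have "\<not> 5 \<le> k"
      using e(7) n unfolding generic_type_coord5[OF eq \<open>a + c = b\<close>] by auto
    then show thesis using that[of a b c] n k by auto
  qed
qed

text \<open>If \<open>2 = 0\<close>, any \<open>x\<close> outside \<open>{0, 1}\<close> yields four
  distinct elements \<open>0\<close>, \<open>1\<close>, \<open>x\<close>,
  \<open>x + 1\<close>.\<close>

lemma two_neq_zero_of_card_3:
  assumes "CARD('a::{field,finite}) = 3"
  shows "(2::'a) \<noteq> 0"
proof
  assume 2: "(2::'a) = 0"
  have "card {0, 1::'a} = 2" by simp
  then have "{0, 1::'a} \<noteq> UNIV" using assms by (metis numeral_eq_iff semiring_norm(89))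
  then obtain x :: 'a where x: "x \<noteq> 0" "x \<noteq> 1" by auto
  have "x + 1 \<noteq> 0" using x 2 by (metis add_right_cancel one_add_one)
  then have "card {0, 1, x, x + 1} = 4" using x by auto
  moreover have "card {0, 1, x, x + 1} \<le> CARD('a)" by (intro card_mono) auto
  ultimately show False using assms by simp
qed

lemma CHAR_eq_2_iff: "CHAR('a::field) = 2 \<longleftrightarrow> (2::'a) = 0"
proof
  assume "CHAR('a) = 2"
  then show "(2::'a) = 0" using of_nat_CHAR[where 'a='a] by simp
next
  assume "(2::'a) = 0"
  then have "CHAR('a) dvd 2" using of_nat_eq_0_iff_char_dvd[of 2, where 'a='a] by simp
  then have "CHAR('a) \<noteq> 0" by (metis dvd_0_left_iff zero_neq_numeral)
  then have "CHAR('a) \<le> 2" using \<open>CHAR('a) dvd 2\<close> by (auto dest: dvd_imp_le)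
  then show "CHAR('a) = 2" using CHAR_not_1' \<open>CHAR('a) \<noteq> 0\<close> by (metis le_SucE le_zero_eq numeral_2_eq_2)
qed

section \<open>Classification of types and the resulting girths\<close>

theorem theorem2:
  shows
    "(\<forall>(u1::'a::{field,finite}) v1 u2 v2 u3 v3 u4 v4.
        0 \<notin> set [u1, v1, u2, v2, u3, v3, u4, v4] \<longrightarrow>
        ((has_cycle_of_type 3 [u1, v1, u2, v2, u3, v3, u4, v4] \<and> v1 + v2 = 0) \<longleftrightarrow>
          (\<exists>r s t. r \<noteq> 0 \<and> s \<noteq> 0 \<and> t \<noteq> 0 \<and>
             [u1, v1, u2, v2, u3, v3, u4, v4] = [r, s, t, -s, -r, s, -t, -s])) \<and>
        ((has_cycle_of_type 4 [u1, v1, u2, v2, u3, v3, u4, v4] \<and> v1 + v2 = 0) \<longleftrightarrow>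
          (CHAR('a) = 2 \<and>
           (\<exists>r s t. r \<noteq> 0 \<and> s \<noteq> 0 \<and> t \<noteq> 0 \<and>
             [u1, v1, u2, v2, u3, v3, u4, v4] = [r, s, t, -s, -r, s, -t, -s]))) \<and>
        ((has_cycle_of_type 3 [u1, v1, u2, v2, u3, v3, u4, v4] \<and> v1 + v2 \<noteq> 0) \<longleftrightarrow>
          (\<exists>t a b c. t \<noteq> 0 \<and> a \<noteq> 0 \<and> b \<noteq> 0 \<and> c \<noteq> 0 \<and> distinct [a, b, c] \<and>
             v1 = a \<and> v2 = b - a \<and> v3 = c - b \<and> v4 = -c \<and>
             u2 = t * b * c * (c - b) \<and> u3 = t * a * c * (a - c) \<and> u4 = t * a * b * (b - a) \<and>
             u1 = t * (c - b) * (a - c) * (b - a))) \<and>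
        ((has_cycle_of_type 4 [u1, v1, u2, v2, u3, v3, u4, v4] \<and> v1 + v2 \<noteq> 0) \<longleftrightarrow>
          (\<exists>t a b c. t \<noteq> 0 \<and> a \<noteq> 0 \<and> b \<noteq> 0 \<and> c \<noteq> 0 \<and> distinct [a, b, c] \<and> a + c = b \<and>
             v1 = a \<and> v2 = b - a \<and> v3 = c - b \<and> v4 = -c \<and>
             u2 = t * b * c * (c - b) \<and> u3 = t * a * c * (a - c) \<and> u4 = t * a * b * (b - a) \<and>
             u1 = t * (c - b) * (a - c) * (b - a)))) \<and>
     (CARD('a) > 3 \<longrightarrow>
        girth (Lambda_graph 3 :: ('a vec + 'a vec) ugraph) = 8 \<and>
        girth (Lambda_graph 4 :: ('a vec + 'a vec) ugraph) = 8) \<and>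
     (CARD('a) = 3 \<longrightarrow>
        girth (Lambda_graph 3 :: ('a vec + 'a vec) ugraph) = 8 \<and>
        girth (Lambda_graph 4 :: ('a vec + 'a vec) ugraph) \<ge> 10) \<and>
     (CARD('a) \<ge> 3 \<longrightarrow>
        girth (Lambda_graph 5 :: ('a vec + 'a vec) ugraph) \<ge> 10)"
proof (intro conjI allI impI, goal_cases)
  \<comment> \<open>Goals 1 to 4 classify the types, goals 5 and 6 are the girths over more than
    three elements, 7 and 8 those over three, and 9 is the bound for \<open>k = 5\<close>.\<close>
  case (1 u1 v1 u2 v2 u3 v3 u4 v4)
  then show ?case
    using has_cycle_of_type_8_iff[OF _ 1, of 3] parallel_type[OF 1] by auto
next
  case (2 u1 v1 u2 v2 u3 v3 u4 v4)
  \<comment> \<open>The right side is the coordinate 4 sum on the family with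
    \<open>v1 + v2 = 0\<close>; it equals \<open>- 2 * (r * s * t)\<close>.\<close>
  have "2 * (r * s * t) = 0 \<longleftrightarrow> r\<^sup>2 * s + (r + t)\<^sup>2 * (- s) + (- t)\<^sup>2 * s = 0" for r s t :: 'a
    by Groebner_Basis.algebra
  then have "(u1\<^sup>2 * v1 + (u1 + u2)\<^sup>2 * v2 + u4\<^sup>2 * v3 = 0 \<longleftrightarrow> CHAR('a) = 2)"
    if "u4 = - u2 \<and> v2 = - v1 \<and> v3 = v1"
    using that 2 by (auto simp: CHAR_eq_2_iff)
  then show ?case
    using has_cycle_of_type_8_iff[OF _ 2, of 4] parallel_type[OF 2] 2 by auto
next
  case (3 u1 v1 u2 v2 u3 v3 u4 v4)
  show ?case (is "?L \<longleftrightarrow> ?R")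
  proof
    assume ?L
    then have z: "v1 + v2 \<noteq> 0" and e: "u1 + u2 + u3 + u4 = 0" "v1 + v2 + v3 + v4 = 0"
      "v1 * u2 + (v1 + v2) * u3 - v4 * u4 = 0" "v1\<^sup>2 * u2 + (v1 + v2)\<^sup>2 * u3 + v4\<^sup>2 * u4 = 0"
      using has_cycle_of_type_8_iff[OF _ 3, of 3] by auto
    show ?R
      by (rule generic_type[OF 3 z e]) blast
  next
    assume ?R
    then obtain t a b c where n: "b \<noteq> 0"
      and eq: "v1 = a" "v2 = b - a" "v3 = c - b" "v4 = - c"
        "u2 = t * b * c * (c - b)" "u3 = t * a * c * (a - c)" "u4 = t * a * b * (b - a)"
        "u1 = t * (c - b) * (a - c) * (b - a)"
      by blast
    have "v1 + v2 \<noteq> 0" using n eq by simp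
    then show ?L
      using has_cycle_of_type_8_iff[OF _ 3, of 3] generic_type_eqs(1-4)[OF eq] by auto
  qed
next
  case (4 u1 v1 u2 v2 u3 v3 u4 v4)
  show ?case (is "?L \<longleftrightarrow> ?R")
  proof
    assume ?L
    then have z: "v1 + v2 \<noteq> 0" and e: "u1 + u2 + u3 + u4 = 0" "v1 + v2 + v3 + v4 = 0"
      "v1 * u2 + (v1 + v2) * u3 - v4 * u4 = 0" "v1\<^sup>2 * u2 + (v1 + v2)\<^sup>2 * u3 + v4\<^sup>2 * u4 = 0"
      "u1\<^sup>2 * v1 + (u1 + u2)\<^sup>2 * v2 + u4\<^sup>2 * v3 = 0"
      using has_cycle_of_type_8_iff[OF _ 4, of 4] by auto
    obtain t a b c where n: "t \<noteq> 0" "a \<noteq> 0" "b \<noteq> 0" "c \<noteq> 0" "distinct [a, b, c]"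
      and eq: "v1 = a" "v2 = b - a" "v3 = c - b" "v4 = - c"
        "u2 = t * b * c * (c - b)" "u3 = t * a * c * (a - c)" "u4 = t * a * b * (b - a)"
        "u1 = t * (c - b) * (a - c) * (b - a)"
      by (rule generic_type[OF 4 z e(1-4)])
    have "a + c = b" using e(5) n unfolding generic_type_eqs(5)[OF eq] by auto
    then show ?R using n eq by blast
  next
    assume ?R
    then obtain t a b c where n: "b \<noteq> 0" "a + c = b"
      and eq: "v1 = a" "v2 = b - a" "v3 = c - b" "v4 = - c"
        "u2 = t * b * c * (c - b)" "u3 = t * a * c * (a - c)" "u4 = t * a * b * (b - a)"
        "u1 = t * (c - b) * (a - c) * (b - a)"
      by blast
    have "v1 + v2 \<noteq> 0" using n eq by simp
    moreover have "u1\<^sup>2 * v1 + (u1 + u2)\<^sup>2 * v2 + u4\<^sup>2 * v3 = 0"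
      using generic_type_eqs(5)[OF eq] n by simp
    ultimately show ?L
      using has_cycle_of_type_8_iff[OF _ 4, of 4] generic_type_eqs(1-4)[OF eq] by auto
  qed
next
  case 5
  \<comment> \<open>The member \<open>r = s = t = 1\<close> of the first family.\<close>
  have "has_cycle_of_type 3 [1, 1, 1, - 1, - 1, 1, - 1, - 1 :: 'a]"
    by (subst has_cycle_of_type_8_iff) auto
  then show ?case by (intro antisym girth_le_8 girth_ge_8) auto
next
  case 6
  have "{0, 1, - 1 :: 'a} \<noteq> UNIV"
  proof
    assume "{0, 1, - 1 :: 'a} = UNIV"
    then have "CARD('a) = card {0, 1, - 1 :: 'a}" by simp
    also have "\<dots> \<le> 3" by (simp add: card_insert_if)
    finally show False using 6 by simp
  qed
  then obtain c :: 'a where c: "c \<noteq> 0" "c \<noteq> 1" "c \<noteq> - 1" by auto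
  have c1: "1 + c \<noteq> 0" using c by (metis add_eq_0_iff)
  \<comment> \<open>A member of the second family with \<open>a + c = b\<close> and
    \<open>t = 1\<close>: \<open>c \<noteq> 1\<close> gives \<open>a \<noteq> c\<close>, and
    \<open>c \<noteq> - 1\<close> gives \<open>b \<noteq> 0\<close>.\<close>
  define a b :: 'a where ab: "a = 1" "b = 1 + c"
  note eqs = generic_type_eqs[where t = 1 and a = a and b = b and c = c, OF refl refl refl refl refl refl refl refl]
  have "has_cycle_of_type 4 [1 * (c - b) * (a - c) * (b - a), a, 1 * b * c * (c - b), b - a,
      1 * a * c * (a - c), c - b, 1 * a * b * (b - a), - c]"
    using eqs c c1 by (subst has_cycle_of_type_8_iff) (auto simp: ab)
  then show ?case by (intro antisym girth_le_8 girth_ge_8) auto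
next
  case 7
  have "has_cycle_of_type 3 [1, 1, 1, - 1, - 1, 1, - 1, - 1 :: 'a]"
    by (subst has_cycle_of_type_8_iff) auto
  then show ?case by (intro antisym girth_le_8 girth_ge_8) auto
next
  case 8
  have "\<not> closed_walk 4 4 l r" for l r :: "nat \<Rightarrow> 'a vec"
  proof
    assume "closed_walk 4 4 l r"
    then obtain a b c :: 'a where "a \<noteq> 0" "b \<noteq> 0" "c \<noteq> 0" "distinct [a, b, c]"
      using two_neq_zero_of_card_3[OF 8] by (elim closed_walk_4_generic) auto
    then have "card {0, a, b, c} = 4" by auto
    moreover have "card {0, a, b, c} \<le> CARD('a)" by (intro card_mono) auto
    ultimately show False using 8 by simp
  qed
  then show ?case by (intro girth_ge_10) auto
next
  case 9
  have "\<not> closed_walk 5 4 l r" for l r :: "nat \<Rightarrow> 'a vec"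
    by (auto elim: closed_walk_4_generic)
  then show ?case by (intro girth_ge_10) auto
qed

end
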